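(* Let $n\ge1$. There exists a bijection $\Psi:\mathcal P_n\to\mathcal P_n$ that preserves the triple of statistics $(\mathsf{larm},\mathsf{rarm},\mathsf{leaf})$ and transforms the statistic $\mathsf{rev}$ to $\mathsf{run}$, i.e. $\mathsf{rev}(T)=\mathsf{run}(\Psi(T))$ for all $T\in\mathcal P_n$. Consequently, $$C_n(x,y,z):=\sum_{T\in\mathcal P_n}x^{\mathsf{larm}(T)-1}y^{\mathsf{rarm}(T)-1}z^{\mathsf{rev}(T)-1}$$ is a symmetric function in $x,y$ and $z$.
   Context: A plane tree is a rooted tree in which the children of each node are linearly ordered (left to right); $\mathcal P_n$ is the set of plane trees with $n$ edges. A node without children is a leaf. A sibling of a node lying to its right is a younger sibling. Preorder on $T$: recursively visit the parent, then the subtrees of its children from left to right; the reverse preorder is the reversal of the preorder. Statistics of $T\in\mathcal P_n$: - $\mathsf{larm}(T)$: number of edges of the left arm, i.e. the path starting at the root and going repeatedly to the leftmost child until a leaf is reached. - $\mathsf{rarm}(T)$: number of edges of the right arm, defined in the same way with rightmost children. - $\mathsf{leaf}(T)$: number of leaves. - $\mathsf{rev}(T)$: number of nodes before the first node, under the reverse preorder, that has a younger sibling; by convention $\mathsf{rev}(T)=n$ if $T$ is the path with $n$ edges. - $\mathsf{run}(T)$: number of non-leaf nodes after (and including) the last node in preorder that has at least two children; by convention $\mathsf{run}(T)=n$ if $T$ is the path with $n$ edges. *)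

theory Defs
  imports Main
begin

datatype ptree = Node (children: "ptree list")

primrec edges :: "ptree \<Rightarrow> nat" where
  "edges (Node ts) = length ts + sum_list (map edges ts)"

definition plane_trees :: "nat \<Rightarrow> ptree set" where
  "plane_trees n = {T. edges T = n}"

text \<open>
  A node is addressed by the list of (0-based) child positions leading to it from the root;
  the root is the empty list. The function \<open>preorder\<close> lists all nodes in preorder.
\<close>

primrec preorder :: "ptree \<Rightarrow> nat list list" where
  "preorder (Node ts) =
     [] # concat (map2 (\<lambda>i vs. map ((#) i) vs) [0..<length ts] (map preorder ts))"

definition nodes :: "ptree \<Rightarrow> nat list set" where
  "nodes T = set (preorder T)"

fun subtree :: "ptree \<Rightarrow> nat list \<Rightarrow> ptree" where
  "subtree T [] = T"
| "subtree T (i # v) = subtree (children T ! i) v"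

definition num_children :: "ptree \<Rightarrow> nat list \<Rightarrow> nat" where
  "num_children T v = length (children (subtree T v))"

definition has_younger_sibling :: "ptree \<Rightarrow> nat list \<Rightarrow> bool" where
  "has_younger_sibling T v \<longleftrightarrow> (\<exists>p i j. v = p @ [i] \<and> p @ [j] \<in> nodes T \<and> i < j)"

definition is_path :: "ptree \<Rightarrow> bool" where
  "is_path T \<longleftrightarrow> (\<forall>v\<in>nodes T. num_children T v \<le> 1)"

primrec larm :: "ptree \<Rightarrow> nat" where
  "larm (Node ts) = (if ts = [] then 0 else Suc (hd (map larm ts)))"

primrec rarm :: "ptree \<Rightarrow> nat" where
  "rarm (Node ts) = (if ts = [] then 0 else Suc (last (map rarm ts)))"

definition leaf :: "ptree \<Rightarrow> nat" where
  "leaf T = card {v \<in> nodes T. num_children T v = 0}"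

text \<open>The statistic \<open>rev\<close>; the name \<open>rev\<close> itself is list reversal.\<close>

definition rev_stat :: "ptree \<Rightarrow> nat" where
  "rev_stat T =
     (if is_path T then edges T
      else length (takeWhile (\<lambda>v. \<not> has_younger_sibling T v) (rev (preorder T))))"

definition run_stat :: "ptree \<Rightarrow> nat" where
  "run_stat T =
     (if is_path T then edges T
      else let vs = preorder T;
               k = Max {i. i < length vs \<and> num_children T (vs ! i) \<ge> 2}
           in card {i. k \<le> i \<and> i < length vs \<and> num_children T (vs ! i) \<noteq> 0})"

text \<open>
  The polynomial \<open>C\<^sub>n\<close>, evaluated at elements of a commutative ring. The ring is arbitrary and may
  itself be a polynomial ring with \<open>x\<close>, \<open>y\<close>, \<open>z\<close> its indeterminates, so an identity valid
  in every commutative ring is an identity of formal polynomials. The truncated subtractions are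
  harmless: for \<open>n \<ge> 1\<close> all three statistics are at least 1.
\<close>

definition C_poly :: "nat \<Rightarrow> 'a \<Rightarrow> 'a \<Rightarrow> 'a \<Rightarrow> 'a::comm_ring_1" where
  "C_poly n x y z =
     (\<Sum>T\<in>plane_trees n. x ^ (larm T - 1) * y ^ (rarm T - 1) * z ^ (rev_stat T - 1))"

definition symmetric3 :: "('a \<Rightarrow> 'a \<Rightarrow> 'a \<Rightarrow> 'b) \<Rightarrow> bool" where
  "symmetric3 f \<longleftrightarrow>
     (\<forall>x y z. f x z y = f x y z \<and> f y x z = f x y z \<and> f y z x = f x y z \<and>
              f z x y = f x y z \<and> f z y x = f x y z)"

text \<open>Finiteness ensures that the sum defining \<open>C_poly\<close> is not the default value 0.\<close>

lemma finite_edges_le: "finite {T. edges T \<le> n}"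
proof (induction n)
  case 0
  have "{T. edges T \<le> 0} \<subseteq> {Node []}"
  proof
    fix T assume "T \<in> {T. edges T \<le> 0}"
    then show "T \<in> {Node []}" by (cases T) auto
  qed
  then show ?case by (rule finite_subset) simp
next
  case (Suc n)
  let ?L = "{ts. set ts \<subseteq> {T. edges T \<le> n} \<and> length ts \<le> Suc n}"
  have "{T. edges T \<le> Suc n} \<subseteq> Node ` ?L"
  proof
    fix T assume "T \<in> {T. edges T \<le> Suc n}"
    moreover obtain ts where T: "T = Node ts" by (cases T)
    ultimately have le: "length ts + sum_list (map edges ts) \<le> Suc n" by simp
    have "edges t \<le> n" if "t \<in> set ts" for t
    proof -
      have "edges t \<le> sum_list (map edges ts)"
        using that by (intro member_le_sum_list) auto
      moreover have "length ts \<ge> 1" using that by (cases ts) auto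
      ultimately show ?thesis using le by linarith
    qed
    then show "T \<in> Node ` ?L" using T le by auto
  qed
  moreover have "finite ?L" using Suc.IH by (rule finite_lists_length_le)
  ultimately show ?case by (meson finite_imageI finite_subset)
qed

lemma finite_plane_trees: "finite (plane_trees n)"
  unfolding plane_trees_def by (rule finite_subset[OF _ finite_edges_le[of n]]) auto

end

theory Submission
  imports Defs "HOL-Computational_Algebra.Formal_Power_Series"
    "HOL-Computational_Algebra.Polynomial" "HOL-Combinatorics.Permutations"
begin

text \<open>
  A plane tree with at least one edge is the same as the pair of its leftmost principal subtree
  \<open>t\<close> and the tree \<open>Node ts\<close> left over when \<open>t\<close> is removed; together they have one edge less.
  All five statistics obey a recursion along this decomposition, so the generating functions
  \<open>A\<close> (for \<open>rev\<close>) and \<open>B\<close> (for \<open>run\<close>) over the trees that are not paths, with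
  \<open>q\<close> marking edges, \<open>t\<close> leaves, \<open>x\<close> and \<open>y\<close> the two arms and \<open>z\<close> the remaining statistic, each satisfy
  a linear functional equation. Solving first for \<open>x = y = 1\<close>, then for \<open>y = 1\<close> and for
  \<open>x = 1\<close>, one finds in both cases
  \<open>q\<^sup>2xyz (t\<^sup>2 + q K L(x) L(y) L(z) (1 - q\<^sup>2xyz K)) / ((1 - qxy) (1 - qyz) (1 - qxz))\<close>,
  where \<open>L(x)\<close> enumerates trees by \<open>larm\<close> and leaves and \<open>K = 1 / (1 - q L(1))\<close>. Hence
  \<open>A = B\<close>, and the visible symmetry in \<open>x, y, z\<close> gives the symmetry of \<open>C\<^sub>n\<close>. Equal
  coefficients yield permutations of the plane trees with \<open>n\<close> edges that match the statistics.
\<close>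

section \<open>Recursions along the left decomposition\<close>

text \<open>Induction on the number of edges, because \<open>Node ts\<close> is not a subtree of
  \<open>Node (t # ts)\<close> and structural induction gives no hypothesis for it.\<close>

lemma ptree_left_induct [case_names leaf graft]:
  assumes "P (Node [])" and "\<And>t ts. P t \<Longrightarrow> P (Node ts) \<Longrightarrow> P (Node (t # ts))"
  shows "P T"
proof (induction "edges T" arbitrary: T rule: less_induct)
  case less
  obtain ts where T: "T = Node ts" by (cases T)
  show ?case
  proof (cases ts)
    case Nil
    then show ?thesis using T assms(1) by simp
  next
    case (Cons s ss)
    then show ?thesis using T less[of s] less[of "Node ss"] assms(2) by simp
  qed
qed

section \<open>Preorder addresses along the decomposition\<close>

definition shift_addr :: "nat list \<Rightarrow> nat list" where
  "shift_addr v = Suc (hd v) # tl v"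

lemma preorder_Nil [simp]: "preorder (Node []) = [[]]"
  by simp

text \<open>The new first child moves the other principal subtrees one position to the right.
  \<open>shift_addr\<close> makes sense on nonempty addresses only, hence the \<open>tl\<close> that
  drops the root.\<close>

lemma preorder_Cons:
  "preorder (Node (t # ts)) =
     [] # map ((#) 0) (preorder t) @ map shift_addr (tl (preorder (Node ts)))"
proof -
  \<comment> \<open>Induction on the list moves the first index from \<open>k\<close> to
    \<open>Suc k\<close>, so \<open>k\<close> is kept arbitrary and set to 0 afterwards.\<close>
  have "concat (map2 (\<lambda>i vs. map ((#) i) vs) [Suc k..<Suc k + length vss] vss) =
      map shift_addr (concat (map2 (\<lambda>i vs. map ((#) i) vs) [k..<k + length vss] vss))"
    for k and vss :: "nat list list list"
  proof (induction vss arbitrary: k)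
    case (Cons vs vss)
    from Cons.IH[of "Suc k"] show ?case
      by (simp add: upt_conv_Cons shift_addr_def del: upt_Suc)
  qed simp
  from this[of 0 "map preorder ts"] show ?thesis
    by (simp add: upt_conv_Cons del: upt_Suc)
qed

declare preorder.simps [simp del]

lemma preorder_eq_Cons: "preorder T = [] # tl (preorder T)"
  by (cases T) (simp add: preorder.simps)

lemma Nil_notin_tl_preorder: "[] \<notin> set (tl (preorder T))"
  by (cases T rule: ptree.exhaust; rename_tac ts; case_tac ts) (auto simp: preorder_Cons shift_addr_def)

lemma tl_preorder_Cons: "v \<in> set (tl (preorder T)) \<Longrightarrow> \<exists>i u. v = i # u"
  using Nil_notin_tl_preorder[of T] by (metis list.exhaust)

lemma Nil_in_nodes [simp]: "[] \<in> nodes T"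
  unfolding nodes_def by (subst preorder_eq_Cons) simp

lemma nodes_leaf [simp]: "nodes (Node []) = {[]}"
  by (simp add: nodes_def)

lemma Zero_Cons_in_nodes [simp]: "0 # v \<in> nodes (Node (t # ts)) \<longleftrightarrow> v \<in> nodes t"
  by (auto simp: nodes_def preorder_Cons shift_addr_def)

lemma Suc_Cons_in_nodes [simp]: "Suc i # v \<in> nodes (Node (t # ts)) \<longleftrightarrow> i # v \<in> nodes (Node ts)"
proof -
  have "i # v \<in> nodes (Node ts) \<longleftrightarrow> i # v \<in> set (tl (preorder (Node ts)))"
    unfolding nodes_def by (subst preorder_eq_Cons) simp
  also have "\<dots> \<longleftrightarrow> Suc i # v \<in> shift_addr ` set (tl (preorder (Node ts)))"
  proof
    assume "i # v \<in> set (tl (preorder (Node ts)))"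
    moreover have "Suc i # v = shift_addr (i # v)" by (simp add: shift_addr_def)
    ultimately show "Suc i # v \<in> shift_addr ` set (tl (preorder (Node ts)))" by blast
  next
    assume "Suc i # v \<in> shift_addr ` set (tl (preorder (Node ts)))"
    then obtain w where w: "w \<in> set (tl (preorder (Node ts)))" "Suc i # v = shift_addr w" by blast
    with tl_preorder_Cons[OF w(1)] show "i # v \<in> set (tl (preorder (Node ts)))"
      by (auto simp: shift_addr_def)
  qed
  also have "\<dots> \<longleftrightarrow> Suc i # v \<in> nodes (Node (t # ts))"
    by (auto simp: nodes_def preorder_Cons)
  finally show ?thesis ..
qed

lemma distinct_preorder: "distinct (preorder T)"
proof (induction T rule: ptree_left_induct)
  case (graft t ts)
  have "inj_on shift_addr (set (tl (preorder (Node ts))))"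
    using Nil_notin_tl_preorder[of "Node ts"]
    by (intro inj_onI) (metis shift_addr_def list.collapse list.inject nat.inject)
  moreover have "distinct (tl (preorder (Node ts)))"
    using graft.IH(2) by (rule distinct_tl)
  ultimately show ?case
    using graft.IH(1) by (auto simp: preorder_Cons distinct_map shift_addr_def)
qed simp

lemma length_preorder: "length (preorder T) = Suc (edges T)"
  by (induction T rule: ptree_left_induct) (simp_all add: preorder_Cons)

text \<open>Preorder degree sequence: \<open>is_path\<close>, \<open>leaf\<close> and
  \<open>run_stat\<close> become properties of a list that splits under grafting.\<close>

definition degrees :: "ptree \<Rightarrow> nat list" where
  "degrees T = map (num_children T) (preorder T)"

lemma degrees_leaf [simp]: "degrees (Node []) = [0]"
  by (simp add: degrees_def num_children_def)

lemma degrees_Cons: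
  "degrees (Node (t # ts)) = Suc (length ts) # degrees t @ tl (degrees (Node ts))"
proof -
  have "num_children (Node (t # ts)) (shift_addr v) = num_children (Node ts) v"
    if "v \<in> set (tl (preorder (Node ts)))" for v
    using tl_preorder_Cons[OF that] by (auto simp: num_children_def shift_addr_def)
  then show ?thesis
    by (simp add: degrees_def preorder_Cons map_tl[symmetric])
      (simp add: num_children_def)
qed

lemma degrees_eq_Cons: "degrees (Node ts) = length ts # tl (degrees (Node ts))"
  by (cases ts) (simp_all add: degrees_Cons)

text \<open>On a non-path, the last \<open>True\<close> marks the node at which
  \<open>rev_stat\<close> stops counting.\<close>

definition younger_flags :: "ptree \<Rightarrow> bool list" where
  "younger_flags T = map (has_younger_sibling T) (preorder T)"

lemma not_younger_Nil [simp]: "\<not> has_younger_sibling T []"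
  by (simp add: has_younger_sibling_def)

lemma younger_flags_leaf [simp]: "younger_flags (Node []) = [False]"
  by (simp add: younger_flags_def)

lemma younger_single: "has_younger_sibling T [i] \<longleftrightarrow> (\<exists>j>i. [j] \<in> nodes T)"
  by (auto simp: has_younger_sibling_def)

lemma younger_Cons:
  "v \<noteq> [] \<Longrightarrow> has_younger_sibling T (i # v) \<longleftrightarrow>
     (\<exists>p k j. v = p @ [k] \<and> i # p @ [j] \<in> nodes T \<and> k < j)"
  by (auto simp: has_younger_sibling_def Cons_eq_append_conv)

lemma singleton_in_nodes: "[j] \<in> nodes (Node ts) \<longleftrightarrow> j < length ts"
proof (induction ts arbitrary: j)
  case (Cons t ts)
  then show ?case by (cases j) auto
qed simp

text \<open>Sibling relations within \<open>t\<close> and within \<open>Node ts\<close> survive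
  grafting. Only the root of \<open>t\<close> acquires siblings, namely the principal subtrees of
  \<open>Node ts\<close>, all of them younger.\<close>

lemma younger_flags_Cons:
  "younger_flags (Node (t # ts)) =
     False # (ts \<noteq> []) # tl (younger_flags t) @ tl (younger_flags (Node ts))"
proof -
  have 1: "has_younger_sibling (Node (t # ts)) (shift_addr v) = has_younger_sibling (Node ts) v"
    if v: "v \<in> set (tl (preorder (Node ts)))" for v
  proof -
    from tl_preorder_Cons[OF v] obtain i u where v: "v = i # u" by auto
    show ?thesis
    proof (cases "u = []")
      case True
      have "(\<exists>j>Suc i. [j] \<in> nodes (Node (t # ts))) \<longleftrightarrow> (\<exists>j>i. [j] \<in> nodes (Node ts))"
        unfolding singleton_in_nodes
        by (metis Suc_less_eq less_Suc_eq_0_disj length_Cons not_less_zero)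
      then show ?thesis using True v by (simp add: shift_addr_def younger_single)
    next
      case False
      then show ?thesis using v by (simp add: shift_addr_def younger_Cons)
    qed
  qed
  have 2: "has_younger_sibling (Node (t # ts)) (0 # v) = has_younger_sibling t v"
    if v: "v \<in> set (tl (preorder t))" for v
  proof -
    from v Nil_notin_tl_preorder[of t] have "v \<noteq> []" by auto
    then show ?thesis
      by (subst younger_Cons) (auto simp: has_younger_sibling_def)
  qed
  have 3: "has_younger_sibling (Node (t # ts)) [0] \<longleftrightarrow> ts \<noteq> []"
    unfolding younger_single singleton_in_nodes by auto
  have "map (\<lambda>v. has_younger_sibling (Node (t # ts)) (0 # v)) (preorder t) =
      (ts \<noteq> []) # map (has_younger_sibling t) (tl (preorder t))"
    using 2 3 by (subst preorder_eq_Cons) simp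
  with 1 show ?thesis
    by (simp add: younger_flags_def preorder_Cons map_tl[symmetric] o_def)
qed

lemma younger_flags_eq_Cons: "younger_flags T = False # tl (younger_flags T)"
  by (cases T) (simp add: younger_flags_def preorder.simps)

lemma is_path_iff_degrees: "is_path T \<longleftrightarrow> (\<forall>d\<in>set (degrees T). d \<le> 1)"
  by (simp add: is_path_def degrees_def nodes_def)

lemma is_path_leaf [simp]: "is_path (Node [])"
  by (simp add: is_path_iff_degrees)

lemma is_path_Cons [simp]: "is_path (Node (t # ts)) \<longleftrightarrow> ts = [] \<and> is_path t"
  by (auto simp: is_path_iff_degrees degrees_Cons)

lemma leaf_eq_degrees: "leaf T = length (filter (\<lambda>d. d = 0) (degrees T))"
  unfolding leaf_def nodes_def degrees_def
  by (simp add: filter_map o_def distinct_length_filter[OF distinct_preorder] Int_def conj_commute)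

lemma leaf_leaf [simp]: "leaf (Node []) = 1"
  by (simp add: leaf_eq_degrees)

lemma leaf_Cons [simp]:
  "leaf (Node (t # ts)) = leaf t + (if ts = [] then 0 else leaf (Node ts))"
  using degrees_eq_Cons[of ts] by (cases ts) (auto simp: leaf_eq_degrees degrees_Cons)

lemma rarm_Cons [simp]:
  "rarm (Node (t # ts)) = (if ts = [] then Suc (rarm t) else rarm (Node ts))"
  by simp

lemma path_stats:
  assumes "is_path T"
  shows "larm T = edges T" "rarm T = edges T" "leaf T = 1"
    "rev_stat T = edges T" "run_stat T = edges T"
proof -
  have "is_path T \<longrightarrow> larm T = edges T \<and> rarm T = edges T \<and> leaf T = 1"
    by (induction T rule: ptree_left_induct) auto
  with assms show "larm T = edges T" "rarm T = edges T" "leaf T = 1" by auto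
  show "rev_stat T = edges T" "run_stat T = edges T"
    using assms by (simp_all add: rev_stat_def run_stat_def)
qed

section \<open>The recursion for \<open>rev_stat\<close>\<close>

lemma is_path_iff_younger_flags: "is_path T \<longleftrightarrow> True \<notin> set (younger_flags T)"
proof (induction T rule: ptree_left_induct)
  case (graft t ts)
  have "set (younger_flags t) = insert False (set (tl (younger_flags t)))"
    by (subst younger_flags_eq_Cons) simp
  with graft.IH(1) show ?case by (auto simp: younger_flags_Cons)
qed simp

lemma rev_stat_split:
  assumes "younger_flags T = us @ True # vs" "True \<notin> set vs"
  shows "rev_stat T = length vs"
proof -
  have "\<not> is_path T" using assms by (simp add: is_path_iff_younger_flags)
  moreover have "length (takeWhile Not (rev (younger_flags T))) = length vs"
    using assms by (auto simp: takeWhile_append)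
  ultimately show ?thesis
    by (simp add: rev_stat_def younger_flags_def rev_map takeWhile_map o_def)
qed

lemma length_younger_flags: "length (younger_flags T) = Suc (edges T)"
  by (simp add: younger_flags_def length_preorder)

text \<open>Reverse preorder meets the nodes of \<open>Node ts\<close> first. If that is a path, all
  its edges are counted and the search goes on in \<open>t\<close>. If \<open>t\<close> is a path
  too and \<open>ts\<close> is nonempty, the search stops at the root of \<open>t\<close> after
  \<open>edges t\<close> more nodes, which is \<open>rev_stat t\<close> by the convention for
  paths.\<close>

lemma rev_stat_Cons:
  "rev_stat (Node (t # ts)) =
     (if \<not> is_path (Node ts) then rev_stat (Node ts)
      else if ts = [] \<and> is_path t then Suc (edges t)
      else edges (Node ts) + rev_stat t)"
proof -
  let ?S = "Node ts"
  have tl: "\<exists>us'. tl (younger_flags T) = us' @ True # vs" if "younger_flags T = us @ True # vs" for T us vs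
    using that younger_flags_eq_Cons[of T] by (cases us) auto
  have set_tl: "set (tl (younger_flags T)) \<subseteq> set (younger_flags T)" for T
    by (subst (2) younger_flags_eq_Cons) auto
  consider "\<not> is_path ?S" | "ts = []" "is_path t" | "is_path ?S" "\<not> is_path t"
    | "is_path ?S" "ts \<noteq> []" "is_path t" by blast
  then show ?thesis
  proof cases
    case 1
    then obtain us vs where s: "younger_flags ?S = us @ True # vs" "True \<notin> set vs"
      by (metis is_path_iff_younger_flags split_list_last)
    from tl[OF s(1)] obtain us' where "tl (younger_flags ?S) = us' @ True # vs" ..
    then have "younger_flags (Node (t # ts)) = (False # (ts \<noteq> []) # tl (younger_flags t) @ us') @ True # vs"
      by (simp add: younger_flags_Cons)
    from rev_stat_split[OF this s(2)] rev_stat_split[OF s] 1 show ?thesis by simp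
  next
    case 2
    then have "is_path (Node (t # ts))" by simp
    from path_stats(4)[OF this] 2 show ?thesis by simp
  next
    case 3
    then obtain us vs where s: "younger_flags t = us @ True # vs" "True \<notin> set vs"
      by (metis is_path_iff_younger_flags split_list_last)
    from tl[OF s(1)] obtain us' where "tl (younger_flags t) = us' @ True # vs" ..
    then have "younger_flags (Node (t # ts)) =
        (False # (ts \<noteq> []) # us') @ True # (vs @ tl (younger_flags ?S))"
      by (simp add: younger_flags_Cons)
    moreover have "True \<notin> set (vs @ tl (younger_flags ?S))"
      using 3(1) s(2) set_tl[of ?S] by (auto simp: is_path_iff_younger_flags)
    ultimately have "rev_stat (Node (t # ts)) = length (vs @ tl (younger_flags ?S))"
      by (rule rev_stat_split)
    then show ?thesis using 3 rev_stat_split[OF s] by (simp add: length_younger_flags)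
  next
    case 4
    have "younger_flags (Node (t # ts)) =
        [False] @ True # (tl (younger_flags t) @ tl (younger_flags ?S))"
      using 4 by (simp add: younger_flags_Cons)
    moreover have "True \<notin> set (tl (younger_flags t) @ tl (younger_flags ?S))"
      using 4 set_tl[of ?S] set_tl[of t] by (auto simp: is_path_iff_younger_flags)
    ultimately have "rev_stat (Node (t # ts)) = length (tl (younger_flags t) @ tl (younger_flags ?S))"
      by (rule rev_stat_split)
    then show ?thesis using 4 path_stats(4)[of t] by (simp add: length_younger_flags)
  qed
qed

section \<open>The recursion for \<open>run_stat\<close>\<close>

lemma card_drop_filter:
  "card {i. k \<le> i \<and> i < length xs \<and> P (xs ! i)} = length (filter P (drop k xs))"
proof -
  have "{i. k \<le> i \<and> i < length xs \<and> P (xs ! i)} =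
      (\<lambda>i. k + i) ` {i. i < length (drop k xs) \<and> P (drop k xs ! i)}"
    by (auto simp: image_iff) (metis add_diff_inverse_nat diff_less_mono leD)
  then show ?thesis
    by (simp add: card_image length_filter_conv_card)
qed

text \<open>The \<open>Suc\<close> stands for the last branching node itself, the entry
  \<open>d\<close>.\<close>

lemma run_stat_split:
  assumes deg: "degrees T = us @ d # vs" and d: "d \<ge> 2" and vs: "\<forall>v\<in>set vs. v \<le> 1"
  shows "run_stat T = Suc (length (filter (\<lambda>d. 0 < d) vs))"
proof -
  let ?ds = "degrees T"
  have eq: "{i. i < length (preorder T) \<and> 2 \<le> num_children T (preorder T ! i)} =
      {i. i < length ?ds \<and> 2 \<le> ?ds ! i}"
    "{i. k \<le> i \<and> i < length (preorder T) \<and> num_children T (preorder T ! i) \<noteq> 0} =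
      {i. k \<le> i \<and> i < length ?ds \<and> 0 < ?ds ! i}" for k
    by (auto simp: degrees_def)
  have "\<not> is_path T" using deg d by (auto simp: is_path_iff_degrees)
  moreover have "Max {i. i < length ?ds \<and> 2 \<le> ?ds ! i} = length us"
  proof (rule Max_eqI)
    fix i assume i: "i \<in> {i. i < length ?ds \<and> 2 \<le> ?ds ! i}"
    show "i \<le> length us"
    proof (rule ccontr)
      assume "\<not> i \<le> length us"
      then obtain j where j: "i = Suc (length us + j)"
        by (metis less_iff_Suc_add not_le)
      then have "?ds ! i = vs ! j" "j < length vs" using i deg by (auto simp: nth_append)
      moreover from this(2) vs have "vs ! j \<le> 1" by simp
      ultimately show False using i by simp
    qed
  qed (use deg d in auto)
  ultimately have "run_stat T = card {i. length us \<le> i \<and> i < length ?ds \<and> 0 < ?ds ! i}"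
    unfolding run_stat_def Let_def eq by simp
  also have "\<dots> = length (filter (\<lambda>d. 0 < d) (drop (length us) ?ds))"
    by (rule card_drop_filter)
  finally show ?thesis using deg d by simp
qed

text \<open>No node except possibly the root branches. This is the condition on
  \<open>Node ts\<close> under which the last branching node of a non-path
  \<open>Node (t # ts)\<close> lies in \<open>t\<close> or is the root.\<close>

definition is_broom :: "ptree \<Rightarrow> bool" where
  "is_broom T \<longleftrightarrow> (\<forall>t\<in>set (children T). is_path t)"

text \<open>For a broom, the number of non-leaf nodes other than the root, since a path has as many
  non-leaf nodes as edges.\<close>

definition lower_edges :: "ptree \<Rightarrow> nat" where
  "lower_edges T = sum_list (map edges (children T))"

lemma broom_simps [simp]:
  "is_broom (Node [])" "is_broom (Node (t # ts)) \<longleftrightarrow> is_path t \<and> is_broom (Node ts)"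
  "lower_edges (Node []) = 0" "lower_edges (Node (t # ts)) = edges t + lower_edges (Node ts)"
  by (simp_all add: is_broom_def lower_edges_def)

lemma is_broom_iff_degrees: "is_broom (Node ts) \<longleftrightarrow> (\<forall>d\<in>set (tl (degrees (Node ts))). d \<le> 1)"
  by (induction ts) (auto simp: degrees_Cons is_path_iff_degrees)

lemma path_nonzero_degrees:
  "is_path T \<Longrightarrow> length (filter (\<lambda>d. 0 < d) (degrees T)) = edges T"
  by (induction T rule: ptree_left_induct) (auto simp: degrees_Cons)

lemma broom_nonzero_degrees:
  "is_broom (Node ts) \<Longrightarrow>
     length (filter (\<lambda>d. 0 < d) (tl (degrees (Node ts)))) = lower_edges (Node ts)"
  by (induction ts) (auto simp: degrees_Cons path_nonzero_degrees)

text \<open>Preorder meets \<open>t\<close> before the rest, so a branching node below the root of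
  \<open>Node ts\<close> decides alone. Otherwise the count starts in \<open>t\<close>, or at the
  root if \<open>t\<close> is a path, and the root then adds 1. For \<open>ts = []\<close> and
  \<open>t\<close> a path, the convention for paths yields the same formula.\<close>

lemma run_stat_Cons:
  "run_stat (Node (t # ts)) =
     (if is_broom (Node ts)
      then run_stat t + lower_edges (Node ts) + (if is_path t then 1 else 0)
      else run_stat (Node ts))"
proof -
  let ?S = "Node ts"
  have last_split: "\<exists>us d vs. ds = us @ d # vs \<and> 2 \<le> d \<and> (\<forall>v\<in>set vs. v \<le> 1)"
    if ds: "\<not> (\<forall>d\<in>set ds. d \<le> 1)" for ds :: "nat list"
  proof -
    from ds have "\<exists>x\<in>set ds. 2 \<le> x" by force
    then obtain us d vs where "ds = us @ d # vs" "2 \<le> d" "\<forall>v\<in>set vs. \<not> 2 \<le> v"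
      by (rule split_list_last_propE)
    moreover from this(3) have "\<forall>v\<in>set vs. v \<le> 1" by force
    ultimately show ?thesis by blast
  qed
  consider "\<not> is_broom ?S" | "is_broom ?S" "\<not> is_path t" | "ts = []" "is_path t"
    | "is_broom ?S" "ts \<noteq> []" "is_path t" by blast
  then show ?thesis
  proof cases
    case 1
    then obtain us d vs where s: "tl (degrees ?S) = us @ d # vs" "2 \<le> d" "\<forall>v\<in>set vs. v \<le> 1"
      using last_split[of "tl (degrees ?S)"] by (auto simp: is_broom_iff_degrees)
    have "degrees (Node (t # ts)) = (Suc (length ts) # degrees t @ us) @ d # vs"
      using s by (simp add: degrees_Cons)
    moreover have "degrees ?S = (length ts # us) @ d # vs"
      by (subst degrees_eq_Cons) (simp add: s)
    ultimately show ?thesis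
      using 1 run_stat_split[OF _ s(2,3)] by simp
  next
    case 2
    then obtain us d vs where s: "degrees t = us @ d # vs" "2 \<le> d" "\<forall>v\<in>set vs. v \<le> 1"
      using last_split[of "degrees t"] by (auto simp: is_path_iff_degrees)
    have "degrees (Node (t # ts)) = (Suc (length ts) # us) @ d # (vs @ tl (degrees ?S))"
      using s by (simp add: degrees_Cons)
    from run_stat_split[OF this s(2)] s(3) 2
    have "run_stat (Node (t # ts)) =
        Suc (length (filter (\<lambda>d. 0 < d) (vs @ tl (degrees ?S))))"
      by (auto simp: is_broom_iff_degrees)
    then show ?thesis using 2 run_stat_split[OF s] by (simp add: broom_nonzero_degrees)
  next
    case 3
    then have "is_path (Node (t # ts))" by simp
    from path_stats(5)[OF this] path_stats(5)[OF 3(2)] 3 show ?thesis by simp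
  next
    case 4
    have "degrees (Node (t # ts)) = [] @ Suc (length ts) # (degrees t @ tl (degrees ?S))"
      by (simp add: degrees_Cons)
    moreover have "2 \<le> Suc (length ts)" using 4 by (cases ts) auto
    moreover have "\<forall>v\<in>set (degrees t @ tl (degrees ?S)). v \<le> 1"
      using 4 by (auto simp: is_path_iff_degrees is_broom_iff_degrees)
    ultimately have "run_stat (Node (t # ts)) =
        Suc (length (filter (\<lambda>d. 0 < d) (degrees t @ tl (degrees ?S))))"
      by (rule run_stat_split)
    then show ?thesis
      using 4 path_stats(5)[of t] by (simp add: broom_nonzero_degrees path_nonzero_degrees)
  qed
qed

section \<open>Generating functions\<close>

definition tree_gf :: "(ptree \<Rightarrow> 'a) \<Rightarrow> 'a::comm_ring_1 fps" where
  "tree_gf w = Abs_fps (\<lambda>n. \<Sum>T\<in>plane_trees n. w T)"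

lemma tree_gf_nth: "fps_nth (tree_gf w) n = (\<Sum>T\<in>plane_trees n. w T)"
  by (simp add: tree_gf_def)

lemma tree_gf_add: "tree_gf (\<lambda>T. v T + w T) = tree_gf v + tree_gf w"
  by (rule fps_ext) (simp add: tree_gf_nth sum.distrib)

lemma tree_gf_cmult: "tree_gf (\<lambda>T. c * w T) = fps_const c * tree_gf w"
  by (rule fps_ext) (simp add: tree_gf_nth sum_distrib_left)

lemma tree_gf_zero: "tree_gf (\<lambda>_. 0) = 0"
  by (rule fps_ext) (simp add: tree_gf_nth)

lemma plane_trees_0: "plane_trees 0 = {Node []}"
proof -
  have "T = Node []" if "edges T = 0" for T
    using that by (cases T) simp
  then show ?thesis by (auto simp: plane_trees_def)
qed

lemma tree_gf_leaf: "tree_gf (\<lambda>T. if T = Node [] then c else 0) = fps_const c"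
proof (rule fps_ext)
  fix n
  have "Node [] \<notin> plane_trees (Suc m)" for m by (simp add: plane_trees_def)
  then show "fps_nth (tree_gf (\<lambda>T. if T = Node [] then c else 0)) n = fps_nth (fps_const c) n"
    by (cases n) (simp_all add: tree_gf_nth plane_trees_0 sum.delta finite_plane_trees)
qed

lemma sum_plane_trees_Suc:
  "(\<Sum>T\<in>plane_trees (Suc n). w T) =
     (\<Sum>i=0..n. \<Sum>t\<in>plane_trees i. \<Sum>S\<in>plane_trees (n - i). w (Node (t # children S)))"
proof -
  let ?J = "SIGMA i:{0..n}. plane_trees i \<times> plane_trees (n - i)"
  have "(\<Sum>T\<in>plane_trees (Suc n). w T) = (\<Sum>(i, t, S)\<in>?J. w (Node (t # children S)))"
  proof (rule sum.reindex_bij_witness[where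
        i = "\<lambda>(i, t, S). Node (t # children S)" and
        j = "\<lambda>T. (edges (hd (children T)), hd (children T), Node (tl (children T)))"])
    fix T assume T: "T \<in> plane_trees (Suc n)"
    then obtain t ts where "T = Node (t # ts)"
      by (cases T; cases "children T") (auto simp: plane_trees_def)
    with T show "(case (edges (hd (children T)), hd (children T), Node (tl (children T))) of
        (i, t, S) \<Rightarrow> Node (t # children S)) = T"
      and "(edges (hd (children T)), hd (children T), Node (tl (children T))) \<in> ?J"
      and "(case (edges (hd (children T)), hd (children T), Node (tl (children T))) of
        (i, t, S) \<Rightarrow> w (Node (t # children S))) = w T"
      by (auto simp: plane_trees_def)
  next
    fix p assume p: "p \<in> ?J"
    obtain i t ts where "p = (i, t, Node ts)" by (metis prod_cases3 ptree.exhaust)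
    with p show "(edges (hd (children (case p of (i, t, S) \<Rightarrow> Node (t # children S)))),
        hd (children (case p of (i, t, S) \<Rightarrow> Node (t # children S))),
        Node (tl (children (case p of (i, t, S) \<Rightarrow> Node (t # children S))))) = p"
      and "(case p of (i, t, S) \<Rightarrow> Node (t # children S)) \<in> plane_trees (Suc n)"
      by (auto simp: plane_trees_def)
  qed
  then show ?thesis
    by (simp add: sum.Sigma finite_plane_trees sum.cartesian_product)
qed

text \<open>Cutting off the first principal subtree makes each product of weights a Cauchy product;
  \<open>fps_X\<close> marks the edge above that subtree. Three summands accommodate the case
  distinctions of both statistics.\<close>

lemma tree_gf_graft:
  assumes "\<And>t ts. w (Node (t # ts)) =
     u\<^sub>1 t * v\<^sub>1 (Node ts) + u\<^sub>2 t * v\<^sub>2 (Node ts) + u\<^sub>3 t * v\<^sub>3 (Node ts)"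
  shows "tree_gf w = fps_const (w (Node [])) + fps_X *
     (tree_gf u\<^sub>1 * tree_gf v\<^sub>1 + tree_gf u\<^sub>2 * tree_gf v\<^sub>2 + tree_gf u\<^sub>3 * tree_gf v\<^sub>3)"
proof (rule fps_ext)
  fix n
  have *: "w (Node (t # children S)) = u\<^sub>1 t * v\<^sub>1 S + u\<^sub>2 t * v\<^sub>2 S + u\<^sub>3 t * v\<^sub>3 S" for t S
    using assms[of t "children S"] by simp
  show "fps_nth (tree_gf w) n = fps_nth (fps_const (w (Node [])) + fps_X *
     (tree_gf u\<^sub>1 * tree_gf v\<^sub>1 + tree_gf u\<^sub>2 * tree_gf v\<^sub>2 + tree_gf u\<^sub>3 * tree_gf v\<^sub>3)) n"
  proof (cases n)
    case (Suc m)
    have X: "fps_nth (fps_const c + fps_X * g) (Suc m) = fps_nth g m" for c :: 'a and g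
      by simp
    show ?thesis unfolding Suc X
      by (simp add: tree_gf_nth sum_plane_trees_Suc * fps_mult_nth sum.distrib sum_product)
  qed (simp add: tree_gf_nth plane_trees_0)
qed

lemma tree_gf_graft1:
  assumes "\<And>t ts. w (Node (t # ts)) = u t * v (Node ts)"
  shows "tree_gf w = fps_const (w (Node [])) + fps_X * tree_gf u * tree_gf v"
  using tree_gf_graft[of w u v "\<lambda>_. 0" "\<lambda>_. 0" "\<lambda>_. 0" "\<lambda>_. 0"] assms
  by (simp add: tree_gf_zero mult.assoc)

text \<open>The markers are integers, not indeterminates: \<open>int fps\<close> is an integral
  domain, and agreement at all integers later gives back the coefficients.\<close>

definition arm_gf :: "int \<Rightarrow> int \<Rightarrow> int fps" where
  "arm_gf t x = tree_gf (\<lambda>T. x ^ larm T * t ^ leaf T)"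

definition path_gf :: "int \<Rightarrow> int \<Rightarrow> int fps" where
  "path_gf t x = tree_gf (\<lambda>T. if is_path T then x ^ edges T * t else 0)"

text \<open>Paths, whose value under both statistics is a convention, are set aside and restored in
  \<open>stat_sum_eq\<close>.\<close>

definition nonpath_gf :: "(ptree \<Rightarrow> nat) \<Rightarrow> int \<Rightarrow> int \<Rightarrow> int \<Rightarrow> int \<Rightarrow> int fps" where
  "nonpath_gf s t x y z = tree_gf (\<lambda>T. if is_path T then 0 else
     x ^ larm T * y ^ rarm T * z ^ s T * t ^ leaf T)"

text \<open>
  Enumerates the part left over after removing the leftmost principal subtree; its root is not
  a leaf of the original tree.
\<close>

definition rest_gf :: "int \<Rightarrow> int fps" where
  "rest_gf t = tree_gf (\<lambda>T. if T = Node [] then 1 else t ^ leaf T)"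

text \<open>\<open>Node []\<close> is excluded: when nothing is left over, the right arm enters the
  first subtree, which is a separate case of the equations.\<close>

definition broom_gf :: "int \<Rightarrow> int \<Rightarrow> int \<Rightarrow> int fps" where
  "broom_gf t y z = tree_gf (\<lambda>T. if is_broom T \<and> T \<noteq> Node [] then
     y ^ rarm T * z ^ lower_edges T * t ^ leaf T else 0)"

definition nonbroom_gf :: "int \<Rightarrow> int \<Rightarrow> int \<Rightarrow> int fps" where
  "nonbroom_gf t y z = tree_gf (\<lambda>T. if is_broom T then 0 else
     y ^ rarm T * z ^ run_stat T * t ^ leaf T)"

section \<open>Functional equations\<close>

lemma path_gf_eq:
  "path_gf t x = fps_const t + fps_X * fps_const x * path_gf t x"
proof -
  have "path_gf t x = fps_const t + fps_X *
      tree_gf (\<lambda>T. x * (if is_path T then x ^ edges T * t else 0)) *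
      tree_gf (\<lambda>T. if T = Node [] then 1 else 0)"
    unfolding path_gf_def by (subst tree_gf_graft1) auto
  then show ?thesis
    by (simp only: tree_gf_cmult tree_gf_leaf path_gf_def[symmetric])
       (simp add: mult.assoc)
qed

lemma arm_gf_eq:
  "arm_gf t x = fps_const t + fps_X * fps_const x * rest_gf t * arm_gf t x"
proof -
  have "arm_gf t x = fps_const t + fps_X *
      tree_gf (\<lambda>T. x * (x ^ larm T * t ^ leaf T)) *
      tree_gf (\<lambda>T. if T = Node [] then 1 else t ^ leaf T)"
    unfolding arm_gf_def by (subst tree_gf_graft1) (auto simp: power_add)
  then show ?thesis
    by (simp only: tree_gf_cmult rest_gf_def[symmetric] arm_gf_def[symmetric])
       (simp add: mult_ac)
qed

lemma arm_gf_1: "arm_gf t 1 = rest_gf t - 1 + fps_const t"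
proof -
  have "(\<lambda>T. 1 ^ larm T * t ^ leaf T) = (\<lambda>T. (if T = Node [] then 1 else t ^ leaf T) +
      (if T = Node [] then t - 1 else 0))"
    by (rule ext) auto
  then have "arm_gf t 1 = rest_gf t + fps_const (t - 1)"
    unfolding arm_gf_def rest_gf_def tree_gf_leaf[symmetric] tree_gf_add[symmetric] by (rule arg_cong)
  also have "fps_const (t - 1) = fps_const t - 1"
    by (simp only: fps_const_sub[symmetric] fps_const_1_eq_1)
  finally show ?thesis by simp
qed

text \<open>The quadratic equation of the Narayana numbers. It says that \<open>rest_gf t\<close> is
  the inverse of \<open>1 - fps_X * arm_gf t 1\<close>.\<close>

lemma rest_gf_eq: "rest_gf t - 1 = fps_X * rest_gf t * (rest_gf t - 1 + fps_const t)"
  using arm_gf_eq[of t 1] unfolding arm_gf_1 by (simp add: algebra_simps)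

lemma path_gf_nonleaf:
  "tree_gf (\<lambda>T. if is_path T \<and> T \<noteq> Node [] then x ^ edges T * t else 0) = path_gf t x - fps_const t"
proof -
  have "(\<lambda>T. if is_path T then x ^ edges T * t else 0) =
      (\<lambda>T. (if is_path T \<and> T \<noteq> Node [] then x ^ edges T * t else 0) + (if T = Node [] then t else 0))"
    by (rule ext) auto
  then show ?thesis
    unfolding path_gf_def by (simp add: tree_gf_add tree_gf_leaf)
qed

text \<open>The summands are the cases of the rest: not a path, a single node, a path with edges. In
  the last case each edge of the rest is on the right arm and counted by \<open>rev_stat\<close>,
  hence \<open>y * z\<close>.\<close>

lemma rev_gf_eq:
  "nonpath_gf rev_stat t x y z =
     fps_X * fps_const x * arm_gf t x * nonpath_gf rev_stat t 1 y z +
     fps_X * fps_const (x * y) * nonpath_gf rev_stat t x y z +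
     fps_X * fps_const x * (path_gf t (y * z) - fps_const t) *
       (nonpath_gf rev_stat t x 1 z + path_gf t (x * z))"
proof -
  let ?w = "\<lambda>T. if is_path T then 0 else x ^ larm T * y ^ rarm T * z ^ rev_stat T * t ^ leaf T"
  have "tree_gf ?w = fps_const (?w (Node [])) + fps_X *
     (tree_gf (\<lambda>T. x * (x ^ larm T * t ^ leaf T)) *
        tree_gf (\<lambda>T. if is_path T then 0 else 1 ^ larm T * y ^ rarm T * z ^ rev_stat T * t ^ leaf T) +
      tree_gf (\<lambda>T. (x * y) * ?w T) * tree_gf (\<lambda>T. if T = Node [] then 1 else 0) +
      tree_gf (\<lambda>T. x *
        ((if is_path T then 0 else x ^ larm T * 1 ^ rarm T * z ^ rev_stat T * t ^ leaf T) +
         (if is_path T then (x * z) ^ edges T * t else 0))) *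
      tree_gf (\<lambda>T. if is_path T \<and> T \<noteq> Node [] then (y * z) ^ edges T * t else 0))"
  proof (rule tree_gf_graft)
    fix s :: ptree and ts
    let ?S = "Node ts"
    consider "\<not> is_path ?S" | "ts = []" | "is_path ?S" "ts \<noteq> []" by blast
    then show "?w (Node (s # ts)) = x * (x ^ larm s * t ^ leaf s) *
        (if is_path ?S then 0 else 1 ^ larm ?S * y ^ rarm ?S * z ^ rev_stat ?S * t ^ leaf ?S) +
      (x * y) * ?w s * (if ?S = Node [] then 1 else 0) +
      x * ((if is_path s then 0 else x ^ larm s * 1 ^ rarm s * z ^ rev_stat s * t ^ leaf s) +
         (if is_path s then (x * z) ^ edges s * t else 0)) *
      (if is_path ?S \<and> ?S \<noteq> Node [] then (y * z) ^ edges ?S * t else 0)"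
    proof cases
      case 1
      then have "ts \<noteq> []" by auto
      with 1 show ?thesis
        by (simp add: rev_stat_Cons power_add mult_ac del: rarm.simps)
    next
      case 2
      then show ?thesis by (simp add: rev_stat_Cons mult_ac del: rarm.simps)
    next
      case 3
      then show ?thesis
        using path_stats[of s] path_stats[of ?S]
        by (simp add: rev_stat_Cons power_add power_mult_distrib mult_ac
            del: rarm.simps edges.simps)
    qed
  qed
  then show ?thesis
    unfolding tree_gf_cmult tree_gf_add tree_gf_leaf path_gf_nonleaf
      arm_gf_def[symmetric] nonpath_gf_def[symmetric] path_gf_def[symmetric]
    by (rule trans) (simp add: algebra_simps del: fps_const_mult)
qed

text \<open>A broom gains legs on the left; its last leg carries the right arm and is therefore
  marked by \<open>y * z\<close>.\<close>

lemma broom_gf_eq: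
  "broom_gf t y z = fps_X * fps_const y * path_gf t (y * z) + fps_X * path_gf t z * broom_gf t y z"
proof -
  let ?w = "\<lambda>T. if is_broom T \<and> T \<noteq> Node [] then y ^ rarm T * z ^ lower_edges T * t ^ leaf T else 0"
  have "tree_gf ?w = fps_const (?w (Node [])) + fps_X *
     (tree_gf (\<lambda>T. y * (if is_path T then (y * z) ^ edges T * t else 0)) *
        tree_gf (\<lambda>T. if T = Node [] then 1 else 0) +
      tree_gf (\<lambda>T. if is_path T then z ^ edges T * t else 0) * tree_gf ?w +
      tree_gf (\<lambda>_. 0) * tree_gf (\<lambda>_. 0))"
  proof (rule tree_gf_graft)
    fix s :: ptree and ts
    show "?w (Node (s # ts)) =
        y * (if is_path s then (y * z) ^ edges s * t else 0) * (if Node ts = Node [] then 1 else 0) +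
        (if is_path s then z ^ edges s * t else 0) * ?w (Node ts) + 0 * 0"
      using path_stats[of s]
      by (simp add: power_add power_mult_distrib mult_ac del: rarm.simps)
  qed
  then show ?thesis
    unfolding tree_gf_cmult tree_gf_leaf tree_gf_zero
      broom_gf_def[symmetric] path_gf_def[symmetric]
    by (rule trans) (simp add: algebra_simps del: fps_const_mult)
qed

lemma nonbroom_gf_eq:
  "nonbroom_gf t y z =
     fps_X * (rest_gf t - 1 + fps_const t) * nonbroom_gf t y z +
     fps_X * fps_const y * nonpath_gf run_stat t 1 y z +
     fps_X * nonpath_gf run_stat t 1 1 z * broom_gf t y z"
proof -
  let ?w = "\<lambda>T. if is_broom T then 0 else y ^ rarm T * z ^ run_stat T * t ^ leaf T"
  let ?d = "\<lambda>T. if is_broom T \<and> T \<noteq> Node [] then y ^ rarm T * z ^ lower_edges T * t ^ leaf T else 0"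
  let ?b = "\<lambda>y T. if is_path T then 0 else 1 ^ larm T * y ^ rarm T * z ^ run_stat T * t ^ leaf T"
  have "tree_gf ?w = fps_const (?w (Node [])) + fps_X *
     (tree_gf (\<lambda>T. 1 ^ larm T * t ^ leaf T) * tree_gf ?w +
      tree_gf (\<lambda>T. y * ?b y T) * tree_gf (\<lambda>T. if T = Node [] then 1 else 0) +
      tree_gf (?b 1) * tree_gf ?d)"
  proof (rule tree_gf_graft)
    fix s :: ptree and ts
    show "?w (Node (s # ts)) = 1 ^ larm s * t ^ leaf s * ?w (Node ts) +
        y * ?b y s * (if Node ts = Node [] then 1 else 0) + ?b 1 s * ?d (Node ts)"
      by (cases "ts = []"; cases "is_broom (Node ts)"; cases "is_path s")
        (simp_all add: run_stat_Cons power_add mult_ac del: rarm.simps)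
  qed
  then show ?thesis
    unfolding tree_gf_cmult tree_gf_leaf arm_gf_1[symmetric]
      arm_gf_def[symmetric] nonpath_gf_def[symmetric] broom_gf_def[symmetric] nonbroom_gf_def[symmetric]
    by (rule trans) (simp add: algebra_simps del: fps_const_mult)
qed

text \<open>The summands are: rest not a broom, rest a single node, rest a broom with edges. The
  extra \<open>fps_const z\<close> counts the root, which is the last branching node when the first
  subtree is a path.\<close>

lemma run_gf_eq:
  "nonpath_gf run_stat t x y z =
     fps_X * fps_const x * arm_gf t x * nonbroom_gf t y z +
     fps_X * fps_const (x * y) * nonpath_gf run_stat t x y z +
     fps_X * fps_const x * broom_gf t y z *
       (fps_const z * path_gf t (x * z) + nonpath_gf run_stat t x 1 z)"
proof -
  let ?w = "\<lambda>y T. if is_path T then 0 else x ^ larm T * y ^ rarm T * z ^ run_stat T * t ^ leaf T"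
  let ?n = "\<lambda>T. if is_broom T then 0 else y ^ rarm T * z ^ run_stat T * t ^ leaf T"
  let ?d = "\<lambda>T. if is_broom T \<and> T \<noteq> Node [] then y ^ rarm T * z ^ lower_edges T * t ^ leaf T else 0"
  have "tree_gf (?w y) = fps_const (?w y (Node [])) + fps_X *
     (tree_gf (\<lambda>T. x * (x ^ larm T * t ^ leaf T)) * tree_gf ?n +
      tree_gf (\<lambda>T. (x * y) * ?w y T) * tree_gf (\<lambda>T. if T = Node [] then 1 else 0) +
      tree_gf (\<lambda>T. x * (z * (if is_path T then (x * z) ^ edges T * t else 0) + ?w 1 T)) * tree_gf ?d)"
  proof (rule tree_gf_graft)
    fix s :: ptree and ts
    show "?w y (Node (s # ts)) = x * (x ^ larm s * t ^ leaf s) * ?n (Node ts) +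
        (x * y) * ?w y s * (if Node ts = Node [] then 1 else 0) +
        x * (z * (if is_path s then (x * z) ^ edges s * t else 0) + ?w 1 s) * ?d (Node ts)"
    proof (cases "is_broom (Node ts)")
      case True
      then show ?thesis
        using path_stats[of s]
        by (cases "ts = []"; cases "is_path s")
          (simp_all add: run_stat_Cons power_add power_mult_distrib mult_ac del: rarm.simps)
    next
      case False
      then have "ts \<noteq> []" "\<not> is_path (Node (s # ts))" by auto
      then show ?thesis
        using False by (simp add: run_stat_Cons power_add del: rarm.simps)
    qed
  qed
  then show ?thesis
    unfolding tree_gf_cmult tree_gf_add tree_gf_leaf
      arm_gf_def[symmetric] nonpath_gf_def[symmetric] path_gf_def[symmetric]
      broom_gf_def[symmetric] nonbroom_gf_def[symmetric]
    by (rule trans) (simp add: algebra_simps del: fps_const_mult)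
qed

section \<open>Solving the functional equations\<close>

text \<open>
  In the following lemmas \<open>q\<close> stands for the formal variable, \<open>K\<close> for \<open>rest_gf t\<close>,
  \<open>L, Lx, Ly\<close> for \<open>arm_gf t\<close> at \<open>z, x, y\<close>, \<open>p, px, py\<close> for \<open>path_gf t\<close> at
  \<open>z, xz, yz\<close>, \<open>d, dy\<close> for \<open>broom_gf t 1 z, broom_gf t y z\<close>, \<open>n, ny\<close> for
  \<open>nonbroom_gf t 1 z, nonbroom_gf t y z\<close>, and \<open>a, ax, ay, A\<close> (\<open>b, bx, by, B\<close>) for the
  generating function of \<open>rev_stat\<close> (\<open>run_stat\<close>) over non-paths at \<open>(1, 1, z)\<close>,
  \<open>(x, 1, z)\<close>, \<open>(1, y, z)\<close>, \<open>(x, y, z)\<close>.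
\<close>

lemma arm_path_identity:
  fixes q :: "'a::idom"
  assumes k: "K - 1 = q * K * (K - 1 + t)" and L: "L = t + q * z * K * L" and p: "p = t + q * z * p"
    and nz: "1 - q * z * K \<noteq> 0" "1 - q * z \<noteq> 0"
  shows "K * L - K * p + z * p = z * K * L - q * z * K * L * p"
proof -
  have "(K * L - K * p + z * p - (z * K * L - q * z * K * L * p)) * ((1 - q * z * K) * (1 - q * z)) = 0"
    using k L p by algebra
  with nz show ?thesis by auto
qed

text \<open>\<open>L - p\<close> enumerates non-paths by \<open>larm\<close>, so
  \<open>rev_stat\<close> and \<open>larm\<close> are equidistributed jointly with
  \<open>leaf\<close>.\<close>

lemma rev_system_unit:
  fixes q :: "'a::idom"
  assumes k: "K - 1 = q * K * (K - 1 + t)" and L: "L = t + q * z * K * L" and p: "p = t + q * z * p"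
    and a: "a = q * (K - 1 + t) * a + q * a + q * (p - t) * (a + p)"
    and nz: "1 - q * K \<noteq> 0" "1 - q * z * K \<noteq> 0"
  shows "a = L - p"
proof -
  have "(a + p - L) * ((1 - q * K) * (1 - q * z * K)) = 0" using k L p a by algebra
  with nz show ?thesis by auto
qed

lemma rev_system_left:
  fixes q :: "'a::idom"
  assumes k: "K * L - K * p + z * p = z * K * L - q * z * K * L * p"
    and L: "L = t + q * z * K * L" "Lx = t + q * x * K * Lx"
    and p: "p = t + q * z * p" "px = t + q * (x * z) * px"
    and a: "ax = q * x * Lx * (L - p) + q * x * ax + q * x * (p - t) * (ax + px)"
    and nz: "1 - q * x * (1 + (p - t)) \<noteq> 0"
  shows "ax * (1 - q * (x * z)) = q ^ 2 * x * z * K * Lx * L"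
proof -
  have 1: "(1 - q * x * (1 + (p - t))) * ax = q * x * Lx * (L - p) + q * x * (p - t) * px"
    using a by algebra
  \<comment> \<open>Times \<open>q * x\<close>, the right side is that of the previous equation
    multiplied by \<open>1 - q * (x * z)\<close>, as \<open>px * (1 - q * (x * z)) = t\<close>. The
    left side gives the claimed value because \<open>L - t = q * z * K * L\<close>.\<close>
  have 2: "(1 - q * x * (1 + (p - t))) * (L - t) * Lx = (1 - q * (x * z)) * Lx * (L - p) + (p - t) * t"
    using k L p(1) by algebra
  have "(ax * (1 - q * (x * z)) - q ^ 2 * x * z * K * Lx * L) * (1 - q * x * (1 + (p - t))) = 0"
    using 1 2 p(2) L(1) by algebra
  with nz show ?thesis by auto
qed

text \<open>Both \<open>Ly * (1 - q * y * K)\<close> and \<open>py * (1 - q * (y * z))\<close> equal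
  \<open>t\<close>, so one denominator can be exchanged for the other.\<close>

lemma cancel_right_arm:
  fixes q :: "'a::idom"
  assumes L: "Ly = t + q * y * K * Ly"
    and p: "py = t + q * (y * z) * py"
    and a: "ay * (1 - q * y * K) = q ^ 2 * y * z * K * py * L"
    and nz: "1 - q * y * K \<noteq> 0"
  shows "ay * (1 - q * (y * z)) = q ^ 2 * y * z * K * Ly * L"
proof -
  have "(ay * (1 - q * (y * z)) - q ^ 2 * y * z * K * Ly * L) * (1 - q * y * K) = 0"
    using L a p by algebra
  with nz show ?thesis by auto
qed

text \<open>Multiplication by \<open>K\<close> turns \<open>1 - q * (K - 1 + t)\<close> into 1; then
  \<open>py - t = q * y * z * py\<close> is inserted.\<close>

lemma rev_system_right:
  fixes q :: "'a::idom"
  assumes k: "K - 1 = q * K * (K - 1 + t)"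
    and p: "py = t + q * (y * z) * py"
    and a: "ay = q * (K - 1 + t) * ay + q * y * ay + q * (py - t) * L"
  shows "ay * (1 - q * y * K) = q ^ 2 * y * z * K * py * L"
  using k p a by algebra

lemma rev_system_closed:
  fixes q :: "'a::idom"
  assumes L: "Ly = t + q * y * K * Ly"
    and p: "px = t + q * (x * z) * px" "py = t + q * (y * z) * py"
    and ax: "ax * (1 - q * (x * z)) = q ^ 2 * x * z * K * Lx * L"
    and ay: "ay * (1 - q * (y * z)) = q ^ 2 * y * z * K * Ly * L"
    and A: "A = q * x * Lx * ay + q * (x * y) * A + q * x * (py - t) * (ax + px)"
  shows "A * ((1 - q * (x * y)) * (1 - q * (y * z)) * (1 - q * (x * z))) =
     q ^ 2 * x * y * z * (t ^ 2 + q * K * Lx * Ly * L * (1 - q ^ 2 * x * y * z * K))"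
proof -
  have 1: "A * (1 - q * (x * y)) = q * x * Lx * ay + q * x * (py - t) * (ax + px)"
    using A by algebra
  have 2: "(py - t) * (1 - q * (y * z)) = q * y * z * t" using p by algebra
  have 3: "px * (1 - q * (x * z)) = t" using p by algebra
  have 4: "(ax + px) * (1 - q * (x * z)) = q ^ 2 * x * z * K * Lx * L + t" unfolding distrib_right 3 ax ..
  have "A * ((1 - q * (x * y)) * (1 - q * (y * z)) * (1 - q * (x * z))) =
     q * x * Lx * (ay * (1 - q * (y * z))) * (1 - q * (x * z)) +
     q * x * ((py - t) * (1 - q * (y * z))) * ((ax + px) * (1 - q * (x * z)))"
    using 1 by algebra
  also have "\<dots> = q * x * Lx * (q ^ 2 * y * z * K * Ly * L) * (1 - q * (x * z)) +
      q * x * (q * y * z * t) * (q ^ 2 * x * z * K * Lx * L + t)"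
    unfolding 2 4 ay ..
  \<comment> \<open>Symmetry appears only after replacing \<open>Ly - t\<close> by
    \<open>q * y * K * Ly\<close>.\<close>
  also have "\<dots> = q ^ 2 * x * y * z * (t ^ 2 + q * K * Lx * Ly * L * (1 - q ^ 2 * x * y * z * K))"
    using L by algebra
  finally show ?thesis .
qed

lemma run_system_unit:
  fixes q :: "'a::idom"
  assumes k: "K - 1 = q * K * (K - 1 + t)" and L: "L = t + q * z * K * L" and p: "p = t + q * z * p"
    and d: "d = q * p + q * p * d"
    and n: "n = q * (K - 1 + t) * n + q * b + q * b * d"
    and b: "b = q * (K - 1 + t) * n + q * b + q * d * (z * p + b)"
    and nz: "1 - q * K \<noteq> 0" "1 - q * z * K \<noteq> 0"
  shows "b = L - p"
proof -
  \<comment> \<open>A broom is a sequence of legs, each enumerated by \<open>q * p\<close>; the 1 is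
    the empty sequence missing from \<open>d\<close>.\<close>
  have 0: "(1 - q * p) * (1 + d) = 1" using d by algebra
  have 1: "n = q * K * b * (1 + d)" using k n by algebra
  have 2: "b = n + q * d * (z * p)" using n b by algebra
  have 3: "b * (1 - q * p - q * K) = q * (q * p) * z * p" using 0 1 2 by algebra
  have 4: "b * ((1 - q * K) * (1 - q * z) - q * t) = q * (q * t) * z * p" using 3 p by algebra
  \<comment> \<open>The quadratic equation reads \<open>q * K * t = (K - 1) * (1 - q * K)\<close>,
    so multiplying by \<open>K\<close> brings out the factor \<open>1 - q * K\<close>.\<close>
  have 5: "b * (1 - q * K) * (1 - q * z * K) = q * z * p * (K - 1) * (1 - q * K)" using 4 k by algebra
  have "(b + p - L) * ((1 - q * K) * (1 - q * z * K)) = 0" using 5 L p by algebra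
  with nz show ?thesis by auto
qed

lemma run_system_left:
  fixes q :: "'a::idom"
  assumes k: "K * L - K * p + z * p = z * K * L - q * z * K * L * p"
    and L: "L = t + q * z * K * L" "Lx = t + q * x * K * Lx"
    and p: "p = t + q * z * p" "px = t + q * (x * z) * px"
    and d: "d = q * p + q * p * d"
    and n: "n = b - q * d * z * p" and b: "b = L - p"
    and bx: "bx = q * x * Lx * n + q * x * bx + q * x * d * (z * px + bx)"
    and nz: "1 - q * x * (1 + d) \<noteq> 0"
  shows "bx * (1 - q * (x * z)) = q ^ 2 * x * z * K * Lx * L"
proof -
  have 0: "(1 - q * p) * (1 + d) = 1" using d by algebra
  have 1: "(1 - q * x * (1 + d)) * bx = q * x * Lx * n + q * x * d * z * px"
    using bx by algebra
  \<comment> \<open>This is the next equation multiplied by \<open>1 - q * p\<close>, which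
    eliminates \<open>d\<close>.\<close>
  have 2: "(1 - q * p - q * x) * (L - t) * Lx = (1 - q * (x * z)) * Lx * ((L - p) * (1 - q * p) - q ^ 2 * p ^ 2 * z) + q * p * z * t"
    using k L p(1) by algebra
  have 3: "(1 - q * x * (1 + d)) * (L - t) * Lx = (1 - q * (x * z)) * Lx * n + d * z * t"
  proof -
    have "(1 - q * x * (1 + d)) * (L - t) * Lx = (1 + d) * ((1 - q * p - q * x) * (L - t) * Lx)"
      using 0 by algebra
    also have "\<dots> = (1 + d) * ((1 - q * (x * z)) * Lx * ((L - p) * (1 - q * p) - q ^ 2 * p ^ 2 * z) + q * p * z * t)"
      unfolding 2 ..
    also have "\<dots> = (1 - q * (x * z)) * Lx * n + d * z * t"
      unfolding n b using 0 by algebra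
    finally show ?thesis .
  qed
  have "(bx * (1 - q * (x * z)) - q ^ 2 * x * z * K * Lx * L) * (1 - q * x * (1 + d)) = 0"
    using 1 3 p(2) L(1) by algebra
  with nz show ?thesis by auto
qed

text \<open>\<open>dy\<close> separates the last leg of a broom from the others. \<open>ny\<close>
  and \<open>n\<close> remove from the non-paths the brooms with at least two legs, whose first leg
  and root give \<open>q * z * p\<close>.\<close>

lemma run_system_right:
  fixes q :: "'a::idom"
  assumes k: "K - 1 = q * K * (K - 1 + t)"
    and L: "L = t + q * z * K * L" and p: "p = t + q * z * p"
    and d: "d = q * p + q * p * d" "dy = q * y * py + q * p * dy"
    and n: "n = q * (K - 1 + t) * n + q * b + q * b * d"
    and b: "b = q * (K - 1 + t) * n + q * b + q * d * (z * p + b)" "b = L - p"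
    and ny: "ny = q * (K - 1 + t) * ny + q * y * by + q * b * dy"
    and by_eq: "by = q * (K - 1 + t) * ny + q * y * by + q * dy * (z * p + b)"
  shows "by * (1 - q * y * K) = q ^ 2 * y * z * K * py * L" "dy = q * y * py * (1 + d)"
     "ny = by - q * z * p * dy" "n = b - q * d * z * p"
proof -
  have 0: "(1 - q * p) * (1 + d) = 1" using d(1) by algebra
  show 1: "dy = q * y * py * (1 + d)" using 0 d(2) by algebra
  show 2: "ny = by - q * z * p * dy" using ny by_eq by algebra
  show 3: "n = b - q * d * z * p" using n b by algebra
  have 4: "by * (1 - q * y * K) = q * dy * (K * b + z * p)" using k ny by_eq by algebra
  have 5: "q * (1 + d) * (K * b + z * p) = b + q * z * p" using n 3 k by algebra
  have 6: "b + q * z * p = q * z * K * L" using b(2) L p by algebra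
  show "by * (1 - q * y * K) = q ^ 2 * y * z * K * py * L" using 1 4 5 6 by algebra
qed

lemma run_system_closed:
  fixes q :: "'a::idom"
  assumes k: "K * L - K * p + z * p = z * K * L - q * z * K * L * p"
    and L: "Ly = t + q * y * K * Ly" "Lx = t + q * x * K * Lx" "L = t + q * z * K * L"
    and p: "px = t + q * (x * z) * px" "py = t + q * (y * z) * py"  "p = t + q * z * p"
    and d: "d = q * p + q * p * d" "dy = q * y * py * (1 + d)"
    and bx: "bx * (1 - q * (x * z)) = q ^ 2 * x * z * K * Lx * L"
    and by_eq: "by * (1 - q * (y * z)) = q ^ 2 * y * z * K * Ly * L"
    and ny: "ny = by - q * z * p * dy"
    and B: "B = q * x * Lx * ny + q * (x * y) * B + q * x * dy * (z * px + bx)"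
  shows "B * ((1 - q * (x * y)) * (1 - q * (y * z)) * (1 - q * (x * z))) =
     q ^ 2 * x * y * z * (t ^ 2 + q * K * Lx * Ly * L * (1 - q ^ 2 * x * y * z * K))"
proof -
  have 0: "(1 - q * p) * (1 + d) = 1" using d(1) by algebra
  have 1: "B * (1 - q * (x * y)) = q * x * (Lx * by + dy * ((z * px + bx) - q * z * p * Lx))"
    using B ny by algebra
  have 2: "dy * (1 - q * (y * z)) = q * y * t * (1 + d)" using p(2) d(2) by algebra
  have 3: "px * (1 - q * (x * z)) = t" using p by algebra
  have "((z * px + bx) - q * z * p * Lx) * (1 - q * (x * z)) =
    z * (px * (1 - q * (x * z))) + bx * (1 - q * (x * z)) - q * z * p * Lx * (1 - q * (x * z))"
    by algebra
  also have "\<dots> = z * t + q ^ 2 * x * z * K * Lx * L - q * z * p * Lx * (1 - q * (x * z))"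
    unfolding 3 bx ..
  also have "\<dots> = z * (t + q * (Lx - t) * L - q * p * Lx * (1 - q * (x * z)))"
    using L(2) by algebra
  finally have 4: "((z * px + bx) - q * z * p * Lx) * (1 - q * (x * z)) =
    z * (t + q * (Lx - t) * L - q * p * Lx * (1 - q * (x * z)))" .
  \<comment> \<open>The factor \<open>1 - q * p\<close> split off here cancels the
    \<open>1 + d\<close> contained in \<open>dy\<close>.\<close>
  have 5: "t + q * (Lx - t) * L - q * p * Lx * (1 - q * (x * z)) = (1 - q * p) * (t + q * z * (Lx - t) * L)"
    using k L(2) by algebra
  have 6: "(1 + d) * (t + q * (Lx - t) * L - q * p * Lx * (1 - q * (x * z))) = t + q * z * (Lx - t) * L"
    using 5 0 by algebra
  have "B * ((1 - q * (x * y)) * (1 - q * (y * z)) * (1 - q * (x * z))) =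
     q * x * (Lx * (by * (1 - q * (y * z))) * (1 - q * (x * z)) + (dy * (1 - q * (y * z))) * (((z * px + bx) - q * z * p * Lx) * (1 - q * (x * z))))"
    using 1 by algebra
  also have "\<dots> = q * x * (Lx * (q ^ 2 * y * z * K * Ly * L) * (1 - q * (x * z)) +
       q * y * t * z * ((1 + d) * (t + q * (Lx - t) * L - q * p * Lx * (1 - q * (x * z)))))"
    unfolding 2 4 by_eq by algebra
  also have "\<dots> = q * x * (Lx * (q ^ 2 * y * z * K * Ly * L) * (1 - q * (x * z)) +
       q * y * t * z * (t + q * z * (Lx - t) * L))"
    unfolding 6 ..
  also have "\<dots> = q ^ 2 * x * y * z * (t ^ 2 + q * K * Lx * Ly * L * (1 - q ^ 2 * x * y * z * K))"
    using L(1,2) by algebra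
  finally show ?thesis .
qed

definition closed_den :: "int \<Rightarrow> int \<Rightarrow> int \<Rightarrow> int fps" where
  "closed_den x y z = (1 - fps_X * (fps_const x * fps_const y)) *
     (1 - fps_X * (fps_const y * fps_const z)) * (1 - fps_X * (fps_const x * fps_const z))"

definition closed_num :: "int \<Rightarrow> int \<Rightarrow> int \<Rightarrow> int \<Rightarrow> int fps" where
  "closed_num t x y z = fps_X ^ 2 * fps_const x * fps_const y * fps_const z *
     (fps_const t ^ 2 + fps_X * rest_gf t * arm_gf t x * arm_gf t y * arm_gf t z *
       (1 - fps_X ^ 2 * fps_const x * fps_const y * fps_const z * rest_gf t))"

section \<open>The solutions applied to the tree series\<close>

lemma fps_nonzeroI: "fps_nth f 0 = 1 \<Longrightarrow> f \<noteq> (0 :: int fps)"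
  by auto

lemma arm_path_gf_identity:
  "rest_gf t * arm_gf t z - rest_gf t * path_gf t z + fps_const z * path_gf t z =
     fps_const z * rest_gf t * arm_gf t z - fps_X * fps_const z * rest_gf t * arm_gf t z * path_gf t z"
  by (rule arm_path_identity[OF rest_gf_eq arm_gf_eq path_gf_eq]; rule fps_nonzeroI; simp)

lemma path_gf_mult_eq:
  "path_gf t (x * y) = fps_const t + fps_X * (fps_const x * fps_const y) * path_gf t (x * y)"
  using path_gf_eq[of t "x * y"] by simp

lemma rev_gf_unit: "nonpath_gf rev_stat t 1 1 z = arm_gf t z - path_gf t z"
proof (rule rev_system_unit[OF rest_gf_eq arm_gf_eq path_gf_eq])
  show "nonpath_gf rev_stat t 1 1 z =
      fps_X * (rest_gf t - 1 + fps_const t) * nonpath_gf rev_stat t 1 1 z +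
      fps_X * nonpath_gf rev_stat t 1 1 z +
      fps_X * (path_gf t z - fps_const t) * (nonpath_gf rev_stat t 1 1 z + path_gf t z)"
    using rev_gf_eq[of t 1 1 z] by (simp add: arm_gf_1)
qed (rule fps_nonzeroI; simp)+

lemma rev_gf_left:
  "nonpath_gf rev_stat t x 1 z * (1 - fps_X * (fps_const x * fps_const z)) =
     fps_X ^ 2 * fps_const x * fps_const z * rest_gf t * arm_gf t x * arm_gf t z"
proof (rule rev_system_left[OF arm_path_gf_identity arm_gf_eq arm_gf_eq path_gf_eq path_gf_mult_eq])
  show "nonpath_gf rev_stat t x 1 z =
      fps_X * fps_const x * arm_gf t x * (arm_gf t z - path_gf t z) +
      fps_X * fps_const x * nonpath_gf rev_stat t x 1 z +
      fps_X * fps_const x * (path_gf t z - fps_const t) *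
        (nonpath_gf rev_stat t x 1 z + path_gf t (x * z))"
    using rev_gf_eq[of t x 1 z] by (simp add: rev_gf_unit)
qed (rule fps_nonzeroI; simp)

lemma rev_gf_right:
  "nonpath_gf rev_stat t 1 y z * (1 - fps_X * (fps_const y * fps_const z)) =
     fps_X ^ 2 * fps_const y * fps_const z * rest_gf t * arm_gf t y * arm_gf t z"
proof (rule cancel_right_arm[OF arm_gf_eq path_gf_mult_eq])
  show "nonpath_gf rev_stat t 1 y z * (1 - fps_X * fps_const y * rest_gf t) =
      fps_X ^ 2 * fps_const y * fps_const z * rest_gf t * path_gf t (y * z) * arm_gf t z"
  proof (rule rev_system_right[OF rest_gf_eq path_gf_mult_eq])
    show "nonpath_gf rev_stat t 1 y z =
        fps_X * (rest_gf t - 1 + fps_const t) * nonpath_gf rev_stat t 1 y z +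
        fps_X * fps_const y * nonpath_gf rev_stat t 1 y z +
        fps_X * (path_gf t (y * z) - fps_const t) * arm_gf t z"
      using rev_gf_eq[of t 1 y z] by (simp add: arm_gf_1 rev_gf_unit)
  qed
qed (rule fps_nonzeroI; simp)

lemma rev_gf_closed:
  "nonpath_gf rev_stat t x y z * closed_den x y z = closed_num t x y z"
  unfolding closed_den_def closed_num_def
proof (rule rev_system_closed[OF arm_gf_eq path_gf_mult_eq path_gf_mult_eq rev_gf_left rev_gf_right])
  show "nonpath_gf rev_stat t x y z =
      fps_X * fps_const x * arm_gf t x * nonpath_gf rev_stat t 1 y z +
      fps_X * (fps_const x * fps_const y) * nonpath_gf rev_stat t x y z +
      fps_X * fps_const x * (path_gf t (y * z) - fps_const t) *
        (nonpath_gf rev_stat t x 1 z + path_gf t (x * z))"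
    using rev_gf_eq[of t x y z] by simp
qed

lemma broom_gf_1: "broom_gf t 1 z = fps_X * path_gf t z + fps_X * path_gf t z * broom_gf t 1 z"
  using broom_gf_eq[of t 1 z] by simp

lemma nonbroom_gf_1:
  "nonbroom_gf t 1 z = fps_X * (rest_gf t - 1 + fps_const t) * nonbroom_gf t 1 z +
     fps_X * nonpath_gf run_stat t 1 1 z + fps_X * nonpath_gf run_stat t 1 1 z * broom_gf t 1 z"
  using nonbroom_gf_eq[of t 1 z] by simp

lemma run_gf_1_eq:
  "nonpath_gf run_stat t 1 y z =
     fps_X * (rest_gf t - 1 + fps_const t) * nonbroom_gf t y z +
     fps_X * fps_const y * nonpath_gf run_stat t 1 y z +
     fps_X * broom_gf t y z * (fps_const z * path_gf t z + nonpath_gf run_stat t 1 1 z)"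
  using run_gf_eq[of t 1 y z] by (simp add: arm_gf_1)

lemma run_gf_unit_eq:
  "nonpath_gf run_stat t 1 1 z =
     fps_X * (rest_gf t - 1 + fps_const t) * nonbroom_gf t 1 z +
     fps_X * nonpath_gf run_stat t 1 1 z +
     fps_X * broom_gf t 1 z * (fps_const z * path_gf t z + nonpath_gf run_stat t 1 1 z)"
  using run_gf_1_eq[of t 1 z] by simp

lemma run_gf_unit: "nonpath_gf run_stat t 1 1 z = arm_gf t z - path_gf t z"
  by (rule run_system_unit[OF rest_gf_eq arm_gf_eq path_gf_eq broom_gf_1 nonbroom_gf_1 run_gf_unit_eq])
    (rule fps_nonzeroI; simp)+

lemmas run_gf_right_aux = run_system_right[OF rest_gf_eq arm_gf_eq path_gf_eq broom_gf_1 broom_gf_eq nonbroom_gf_1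
  run_gf_unit_eq run_gf_unit nonbroom_gf_eq run_gf_1_eq]

lemma run_gf_left:
  "nonpath_gf run_stat t x 1 z * (1 - fps_X * (fps_const x * fps_const z)) =
     fps_X ^ 2 * fps_const x * fps_const z * rest_gf t * arm_gf t x * arm_gf t z"
proof (rule run_system_left[OF arm_path_gf_identity arm_gf_eq arm_gf_eq path_gf_eq path_gf_mult_eq broom_gf_1
    run_gf_right_aux(4) run_gf_unit])
  show "nonpath_gf run_stat t x 1 z =
      fps_X * fps_const x * arm_gf t x * nonbroom_gf t 1 z +
      fps_X * fps_const x * nonpath_gf run_stat t x 1 z +
      fps_X * fps_const x * broom_gf t 1 z *
        (fps_const z * path_gf t (x * z) + nonpath_gf run_stat t x 1 z)"
    using run_gf_eq[of t x 1 z] by simp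
qed (rule fps_nonzeroI; simp)

lemma run_gf_right:
  "nonpath_gf run_stat t 1 y z * (1 - fps_X * (fps_const y * fps_const z)) =
     fps_X ^ 2 * fps_const y * fps_const z * rest_gf t * arm_gf t y * arm_gf t z"
  by (rule cancel_right_arm[OF arm_gf_eq path_gf_mult_eq run_gf_right_aux(1)[of t y z, unfolded fps_const_mult[symmetric]]])
    (rule fps_nonzeroI; simp)

lemma run_gf_closed:
  "nonpath_gf run_stat t x y z * closed_den x y z = closed_num t x y z"
  unfolding closed_den_def closed_num_def
proof (rule run_system_closed[OF arm_path_gf_identity arm_gf_eq arm_gf_eq arm_gf_eq path_gf_mult_eq path_gf_mult_eq path_gf_eq
    broom_gf_1 run_gf_right_aux(2) run_gf_left run_gf_right run_gf_right_aux(3)])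
  show "nonpath_gf run_stat t x y z =
      fps_X * fps_const x * arm_gf t x * nonbroom_gf t y z +
      fps_X * (fps_const x * fps_const y) * nonpath_gf run_stat t x y z +
      fps_X * fps_const x * broom_gf t y z *
        (fps_const z * path_gf t (x * z) + nonpath_gf run_stat t x 1 z)"
    using run_gf_eq[of t x y z] by simp
qed

lemma closed_den_nonzero: "closed_den x y z \<noteq> 0"
  by (rule fps_nonzeroI) (simp add: closed_den_def)

lemma rev_gf_eq_run_gf: "nonpath_gf rev_stat t x y z = nonpath_gf run_stat t x y z"
  using rev_gf_closed[of t x y z] run_gf_closed[of t x y z] closed_den_nonzero[of x y z]
  by (metis mult_right_cancel)

lemma rev_gf_swap:
  "nonpath_gf rev_stat t y x z = nonpath_gf rev_stat t x y z"
  "nonpath_gf rev_stat t x z y = nonpath_gf rev_stat t x y z"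
proof -
  have "closed_den y x z = closed_den x y z" "closed_num t y x z = closed_num t x y z"
    "closed_den x z y = closed_den x y z" "closed_num t x z y = closed_num t x y z"
    by (simp_all only: closed_den_def closed_num_def mult_ac)
  then show "nonpath_gf rev_stat t y x z = nonpath_gf rev_stat t x y z"
    "nonpath_gf rev_stat t x z y = nonpath_gf rev_stat t x y z"
    using rev_gf_closed[of t x y z] rev_gf_closed[of t y x z] rev_gf_closed[of t x z y]
      closed_den_nonzero[of x y z]
    by (metis mult_right_cancel)+
qed

section \<open>From generating functions to bijections\<close>

text \<open>The factors are ordered so that the powers of \<open>x\<close>, \<open>y\<close>,
  \<open>z\<close>, \<open>t\<close> can be stripped from the right in turn.\<close>

definition stat_sum ::
  "(ptree \<Rightarrow> nat) \<Rightarrow> (ptree \<Rightarrow> nat) \<Rightarrow> (ptree \<Rightarrow> nat) \<Rightarrow> nat \<Rightarrow> int \<Rightarrow> int \<Rightarrow> int \<Rightarrow> int \<Rightarrow> int" where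
  "stat_sum f g h n t x y z =
     (\<Sum>T\<in>plane_trees n. t ^ leaf T * z ^ h T * y ^ g T * x ^ f T)"

lemma stat_sum_eq:
  assumes "\<And>T. is_path T \<Longrightarrow> s T = edges T"
  shows "stat_sum larm rarm s n t x y z =
    fps_nth (nonpath_gf s t x y z + path_gf t (x * y * z)) n"
  unfolding stat_sum_def nonpath_gf_def path_gf_def tree_gf_add[symmetric] tree_gf_nth
  by (rule sum.cong) (auto simp: path_stats assms power_mult_distrib)

text \<open>Both sides of the assumption are polynomials in \<open>x\<close> that agree at all
  integers, so their coefficients at \<open>i\<close> agree.\<close>

lemma sum_powers_fibers:
  fixes c d :: "'a \<Rightarrow> int"
  assumes "finite S" "finite S'"
    and eq: "\<And>x. (\<Sum>T\<in>S. c T * x ^ f T) = (\<Sum>T\<in>S'. d T * x ^ g T)"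
  shows "(\<Sum>T\<in>{T\<in>S. f T = i}. c T) = (\<Sum>T\<in>{T\<in>S'. g T = i}. d T)"
proof -
  have coeff: "coeff (\<Sum>T\<in>S. monom (c T) (f T)) i = (\<Sum>T\<in>{T\<in>S. f T = i}. c T)"
    if "finite S" for S and c :: "'a \<Rightarrow> int" and f
    using that by (simp add: coeff_sum sum.inter_filter)
  have "poly (\<Sum>T\<in>S. monom (c T) (f T)) = poly (\<Sum>T\<in>S'. monom (d T) (g T))"
    using eq by (simp add: fun_eq_iff poly_sum poly_monom)
  then have "(\<Sum>T\<in>S. monom (c T) (f T)) = (\<Sum>T\<in>S'. monom (d T) (g T))"
    by (simp add: poly_eq_poly_eq_iff)
  with coeff[OF assms(1), of c f] coeff[OF assms(2), of d g] show ?thesis by simp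
qed

text \<open>Comparing coefficients in one variable at a time shows that the fibres of the joint
  statistics have equal size. The image multisets then agree, and a permutation matches the
  fibres.\<close>

lemma stat_bijection:
  assumes "\<And>t x y z. stat_sum f g h n t x y z = stat_sum f' g' h' n t x y z"
  shows "\<exists>p. p permutes plane_trees n \<and> (\<forall>T\<in>plane_trees n.
      leaf (p T) = leaf T \<and> f' (p T) = f T \<and> g' (p T) = g T \<and> h' (p T) = h T)"
proof -
  let ?P = "plane_trees n"
  let ?F = "\<lambda>T. (((f T, g T), h T), leaf T)" and ?F' = "\<lambda>T. (((f' T, g' T), h' T), leaf T)"
  note fin = finite_plane_trees[of n]
  have 1: "(\<Sum>T\<in>{T\<in>?P. f T = i}. t ^ leaf T * z ^ h T * y ^ g T) =
      (\<Sum>T\<in>{T\<in>?P. f' T = i}. t ^ leaf T * z ^ h' T * y ^ g' T)" for i and t y z :: int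
    by (rule sum_powers_fibers) (use assms fin in \<open>auto simp: stat_sum_def\<close>)
  have 2: "(\<Sum>T\<in>{T\<in>{T\<in>?P. f T = i}. g T = j}. t ^ leaf T * z ^ h T) =
      (\<Sum>T\<in>{T\<in>{T\<in>?P. f' T = i}. g' T = j}. t ^ leaf T * z ^ h' T)" for i j and t z :: int
    by (rule sum_powers_fibers) (use 1 fin in auto)
  have 3: "(\<Sum>T\<in>{T\<in>{T\<in>{T\<in>?P. f T = i}. g T = j}. h T = k}. t ^ leaf T) =
      (\<Sum>T\<in>{T\<in>{T\<in>{T\<in>?P. f' T = i}. g' T = j}. h' T = k}. t ^ leaf T)" for i j k and t :: int
    by (rule sum_powers_fibers) (use 2 fin in auto)
  have "(\<Sum>T\<in>{T\<in>{T\<in>{T\<in>{T\<in>?P. f T = i}. g T = j}. h T = k}. leaf T = l}. 1::int) =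
      (\<Sum>T\<in>{T\<in>{T\<in>{T\<in>{T\<in>?P. f' T = i}. g' T = j}. h' T = k}. leaf T = l}. 1)" for i j k l
    by (rule sum_powers_fibers) (use 3 fin in auto)
  moreover have "{T\<in>{T\<in>{T\<in>{T\<in>?P. f T = i}. g T = j}. h T = k}. leaf T = l} =
      {T\<in>?P. (((f T, g T), h T), leaf T) = (((i, j), k), l)}" for f g h :: "ptree \<Rightarrow> nat" and i j k l
    by auto
  ultimately have card: "card {T\<in>?P. ?F T = v} = card {T\<in>?P. ?F' T = v}" for v
    by (cases v) (auto simp: split_paired_all)
  have "image_mset ?F (mset_set ?P) = image_mset ?F' (mset_set ?P)"
  proof (rule multiset_eqI)
    fix v
    have "count (image_mset G (mset_set ?P)) v = card {T\<in>?P. G T = v}" for G :: "ptree \<Rightarrow> ((nat \<times> nat) \<times> nat) \<times> nat"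
      using fin by (simp add: count_image_mset_eq_card_vimage)
    with card show "count (image_mset ?F (mset_set ?P)) v = count (image_mset ?F' (mset_set ?P)) v"
      by simp
  qed
  from image_mset_eq_implies_permutes[OF fin this]
  obtain p where "p permutes ?P" "\<forall>T\<in>?P. ?F T = ?F' (p T)" by blast
  then show ?thesis by (intro exI[of _ p]) auto
qed

text \<open>Reindexing by a permutation carries the symmetry from integers to any commutative
  ring.\<close>

lemma C_poly_permute:
  assumes p: "p permutes plane_trees n"
    and eq: "\<And>T. T \<in> plane_trees n \<Longrightarrow>
      x ^ (larm T - 1) * y ^ (rarm T - 1) * z ^ (rev_stat T - 1) =
      x' ^ (larm (p T) - 1) * y' ^ (rarm (p T) - 1) * z' ^ (rev_stat (p T) - 1)"
  shows "C_poly n x y z = C_poly n x' y' z'"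
  unfolding C_poly_def
  by (subst (2) sum.permute[OF p]) (simp only: o_def, rule sum.cong[OF refl eq])

lemma C_poly_swap12: "C_poly n y x z = C_poly n x y z"
proof -
  have s: "stat_sum rarm larm rev_stat n t x y z = stat_sum larm rarm rev_stat n t y x z" for t x y z
    by (simp add: stat_sum_def mult_ac)
  have "stat_sum larm rarm rev_stat n t x y z = stat_sum rarm larm rev_stat n t x y z" for t x y z
    unfolding s by (simp add: stat_sum_eq path_stats rev_gf_swap(1)[of t y x z] mult_ac)
  from stat_bijection[OF this] obtain p where p: "p permutes plane_trees n"
    and stats: "\<And>T. T \<in> plane_trees n \<Longrightarrow>
      leaf (p T) = leaf T \<and> rarm (p T) = larm T \<and> larm (p T) = rarm T \<and> rev_stat (p T) = rev_stat T"
    by blast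
  show ?thesis by (intro C_poly_permute[OF p]) (simp add: stats mult_ac)
qed

lemma C_poly_swap23: "C_poly n x z y = C_poly n x y z"
proof -
  have s: "stat_sum larm rev_stat rarm n t x y z = stat_sum larm rarm rev_stat n t x z y" for t x y z
    by (simp add: stat_sum_def mult_ac)
  have "stat_sum larm rarm rev_stat n t x y z = stat_sum larm rev_stat rarm n t x y z" for t x y z
    unfolding s by (simp add: stat_sum_eq path_stats rev_gf_swap(2)[of t x z y] mult_ac)
  from stat_bijection[OF this] obtain p where p: "p permutes plane_trees n"
    and stats: "\<And>T. T \<in> plane_trees n \<Longrightarrow>
      leaf (p T) = leaf T \<and> larm (p T) = larm T \<and> rev_stat (p T) = rarm T \<and> rarm (p T) = rev_stat T"
    by blast
  show ?thesis by (intro C_poly_permute[OF p]) (simp add: stats mult_ac)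
qed

theorem theorem3p6:
  fixes n :: nat
  assumes "n \<ge> 1"
  shows "(\<exists>\<Psi>. bij_betw \<Psi> (plane_trees n) (plane_trees n) \<and>
            (\<forall>T\<in>plane_trees n.
               larm (\<Psi> T) = larm T \<and> rarm (\<Psi> T) = rarm T \<and> leaf (\<Psi> T) = leaf T \<and>
               rev_stat T = run_stat (\<Psi> T))) \<and>
         symmetric3 (C_poly n :: 'a \<Rightarrow> 'a \<Rightarrow> 'a \<Rightarrow> 'a::comm_ring_1)"
proof
  have "stat_sum larm rarm rev_stat n t x y z = stat_sum larm rarm run_stat n t x y z" for t x y z
    by (simp add: stat_sum_eq path_stats rev_gf_eq_run_gf)
  from stat_bijection[OF this] obtain p where "p permutes plane_trees n"
    and stats: "\<And>T. T \<in> plane_trees n \<Longrightarrow>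
      leaf (p T) = leaf T \<and> larm (p T) = larm T \<and> rarm (p T) = rarm T \<and> run_stat (p T) = rev_stat T"
    by blast
  then show "\<exists>\<Psi>. bij_betw \<Psi> (plane_trees n) (plane_trees n) \<and>
            (\<forall>T\<in>plane_trees n.
               larm (\<Psi> T) = larm T \<and> rarm (\<Psi> T) = rarm T \<and> leaf (\<Psi> T) = leaf T \<and>
               rev_stat T = run_stat (\<Psi> T))"
    by (intro exI[of _ p]) (auto simp: permutes_imp_bij stats)
  show "symmetric3 (C_poly n :: 'a \<Rightarrow> 'a \<Rightarrow> 'a \<Rightarrow> 'a)"
    \<comment> \<open>The two adjacent transpositions generate all permutations of the
      arguments.\<close>
    unfolding symmetric3_def by (metis C_poly_swap12 C_poly_swap23)
qed

end
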